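(* Let $Q=\{q_1,q_2,\ldots,q_k\}$ be a finite set of primes. The density of the set of all integers that are not divisible by any prime in $Q$ is $$\prod_{q\in Q}\left(1-\frac1q\right).$$
   Context: The density of a set $A$ of integers is its natural density over the natural numbers, $\lim_{N\to\infty}\frac1N\#\{1\le n\le N: n\in A\}$. *)

theory Defs
  imports Complex_Main "HOL-Computational_Algebra.Primes"
begin

text \<open>
  Natural density over the positive integers: non-positive elements of \<open>A\<close> play no role.
  As a relation, it asserts both that the limit exists and that it equals \<open>d\<close>.
  The term for \<open>N = 0\<close> is \<open>0 / 0 = 0\<close> and does not affect the limit.
\<close>

definition has_density :: "int set \<Rightarrow> real \<Rightarrow> bool" where
  "has_density A d \<longleftrightarrow>
     (\<lambda>N::nat. real (card {n \<in> {1..int N}. n \<in> A}) / real N) \<longlonglongrightarrow> d"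

end

theory Submission
  imports Defs
begin

text \<open>
  The sieve is built one modulus at a time. Let \<open>A\<close> be the set of integers divisible by no element
  of \<open>Q\<close>, and let \<open>q\<close> be coprime to every element of \<open>Q\<close>. Passing from \<open>Q\<close> to \<open>insert q Q\<close>
  removes from \<open>A\<close> its multiples of \<open>q\<close>. By coprimality, \<open>q * m\<close> lies in \<open>A\<close> exactly when \<open>m\<close> does,
  so what is removed is the dilate \<open>q * A\<close>, whose density is that of \<open>A\<close> divided by \<open>q\<close>
  (\<open>has_density_dilate\<close>). Each modulus therefore contributes a factor \<open>1 - 1 / q\<close>
  (\<open>has_density_Diff\<close>), and induction over \<open>Q\<close> gives the product for every finite set of pairwise
  coprime positive moduli. Distinct primes are such moduli.
\<close>

lemma has_density_UNIV: "has_density UNIV 1"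
proof -
  have "\<forall>\<^sub>F N::nat in sequentially. real (card {n \<in> {1..int N}. n \<in> UNIV}) / real N = 1"
    using eventually_gt_at_top[of 0]
  proof eventually_elim
    case (elim N)
    have "{n \<in> {1..int N}. n \<in> UNIV} = {1..int N}" by blast
    then show ?case using elim by (simp only: card_atLeastAtMost_int) simp
  qed
  then show ?thesis
    unfolding has_density_def by (rule tendsto_eventually)
qed

lemma has_density_Diff:
  assumes "has_density A a" "has_density B b" "B \<subseteq> A"
  shows "has_density (A - B) (a - b)"
proof -
  have "real (card {n \<in> {1..int N}. n \<in> A - B}) / real N =
        real (card {n \<in> {1..int N}. n \<in> A}) / real N -
        real (card {n \<in> {1..int N}. n \<in> B}) / real N" for N
  proof -
    let ?A = "{n \<in> {1..int N}. n \<in> A}" and ?B = "{n \<in> {1..int N}. n \<in> B}"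
    have sub: "?B \<subseteq> ?A" using assms(3) by auto
    have fin: "finite ?A" by (rule finite_subset[of _ "{1..int N}"]) auto
    have "{n \<in> {1..int N}. n \<in> A - B} = ?A - ?B" by auto
    moreover have "card (?A - ?B) = card ?A - card ?B"
      using sub fin by (intro card_Diff_subset) (auto intro: finite_subset)
    moreover have "card ?B \<le> card ?A"
      using sub fin by (intro card_mono)
    ultimately show ?thesis by (simp add: of_nat_diff diff_divide_distrib)
  qed
  then show ?thesis
    using tendsto_diff[OF assms(1,2)[unfolded has_density_def]] by (simp add: has_density_def)
qed

lemma tendsto_div_quotient:
  assumes "q > (0::nat)"
  shows "(\<lambda>N. real (N div q) / real N) \<longlonglongrightarrow> 1 / real q"
proof (rule tendsto_sandwich)
  show "\<forall>\<^sub>F N in sequentially. 1 / real q - 1 / real N \<le> real (N div q) / real N"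
    using eventually_gt_at_top[of 0]
  proof eventually_elim
    case (elim N)
    have "real N / real q - 1 \<le> real (N div q)"
      using floor_divide_of_nat_eq[of N q, where 'a=real] by linarith
    then have "(real N / real q - 1) / real N \<le> real (N div q) / real N"
      by (rule divide_right_mono) simp
    then show ?case using elim by (simp add: diff_divide_distrib)
  qed
  show "\<forall>\<^sub>F N in sequentially. real (N div q) / real N \<le> 1 / real q"
    using eventually_gt_at_top[of 0]
  proof eventually_elim
    case (elim N)
    have "real (N div q) \<le> real N / real q"
      using floor_divide_of_nat_eq[of N q, where 'a=real] by linarith
    then have "real (N div q) / real N \<le> (real N / real q) / real N"
      by (rule divide_right_mono) simp
    then show ?case using elim by simp
  qed
  show "(\<lambda>N. 1 / real q - 1 / real N) \<longlonglongrightarrow> 1 / real q"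
    using tendsto_diff[OF tendsto_const lim_1_over_n, of "1 / real q"] by simp
qed simp

text \<open>
  The elements of \<open>q * A\<close> up to \<open>N\<close> correspond to the elements of \<open>A\<close> up to \<open>N div q\<close>. With
  \<open>C\<close> the counting function of \<open>A\<close> and \<open>M = N div q\<close>, the proportion at \<open>N\<close> is
  \<open>(C M / M) * (M / N)\<close>, whose factors tend to \<open>d\<close> and \<open>1 / q\<close>.
\<close>

lemma has_density_dilate:
  assumes "has_density A d" "q > (0::nat)"
  shows "has_density ((\<lambda>m. int q * m) ` A) (d / real q)"
proof -
  define C where "C N = card {n \<in> {1..int N}. n \<in> A}" for N
  have count: "card {n \<in> {1..int N}. n \<in> (\<lambda>m. int q * m) ` A} = C (N div q)" for N
  proof -
    have "1 \<le> int q * m \<and> int q * m \<le> int N \<longleftrightarrow> 1 \<le> m \<and> m \<le> int (N div q)" for m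
    proof -
      have "m \<le> int N div int q \<longleftrightarrow> m * int q \<le> int N"
      proof -
        have "m \<le> int N div int q \<longleftrightarrow> real_of_int m * real q \<le> real N"
          using floor_divide_of_nat_eq[of N q, where 'a=real] assms(2)
          by (metis le_floor_iff of_nat_0_less_iff pos_le_divide_eq zdiv_int)
        also have "\<dots> \<longleftrightarrow> m * int q \<le> int N"
          by (metis of_int_le_iff of_int_mult of_int_of_nat_eq)
        finally show ?thesis .
      qed
      moreover have "0 < int q * m \<longleftrightarrow> 0 < m"
        using assms(2) by (simp add: zero_less_mult_iff)
      ultimately show ?thesis by (auto simp: zdiv_int mult.commute)
    qed
    then have "{n \<in> {1..int N}. n \<in> (\<lambda>m. int q * m) ` A} =
        (\<lambda>m. int q * m) ` {m \<in> {1..int (N div q)}. m \<in> A}" by auto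
    then show ?thesis
      using assms(2) by (simp add: C_def card_image inj_on_def)
  qed
  have "filterlim (\<lambda>N. N div q) sequentially sequentially"
    unfolding filterlim_at_top
  proof (intro allI)
    fix Z
    show "\<forall>\<^sub>F N in sequentially. Z \<le> N div q"
      using eventually_ge_at_top[of "Z * q"]
      by eventually_elim (simp add: less_eq_div_iff_mult_less_eq assms(2))
  qed
  then have "(\<lambda>N. real (C (N div q)) / real (N div q)) \<longlonglongrightarrow> d"
    using assms(1) unfolding has_density_def C_def[symmetric] by (rule filterlim_compose[rotated])
  then have "(\<lambda>N. real (C (N div q)) / real (N div q) * (real (N div q) / real N)) \<longlonglongrightarrow> d * (1 / real q)"
    using tendsto_div_quotient[OF assms(2)] by (rule tendsto_mult)
  \<comment> \<open>Cancelling \<open>N div q\<close> is sound even when it is zero, since then nothing is counted.\<close>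
  moreover have "real (C (N div q)) / real (N div q) * (real (N div q) / real N) =
      real (C (N div q)) / real N" for N
    by (cases "N div q = 0") (simp_all add: C_def)
  ultimately show ?thesis
    by (simp only: has_density_def count times_divide_eq_right mult_1_right)
qed

lemma has_density_sieve_pairwise_coprime:
  fixes Q :: "nat set"
  assumes "finite Q" "\<And>q. q \<in> Q \<Longrightarrow> q > 0" "pairwise coprime Q"
  shows "has_density {n :: int. \<forall>q\<in>Q. \<not> int q dvd n} (\<Prod>q\<in>Q. (1 - 1 / real q))"
  using assms
proof (induction Q rule: finite_induct)
  case empty
  then show ?case using has_density_UNIV by simp
next
  case (insert q Q)
  define A where "A = {n :: int. \<forall>r\<in>Q. \<not> int r dvd n}"
  define P where "P = (\<Prod>r\<in>Q. (1 - 1 / real r))"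
  have dens: "has_density A P"
    unfolding A_def P_def using insert by (simp add: pairwise_insert)
  have dilate: "int q * m \<in> A \<longleftrightarrow> m \<in> A" for m
  proof -
    have "int r dvd int q * m \<longleftrightarrow> int r dvd m" if "r \<in> Q" for r
    proof -
      have "coprime (int r) (int q)"
        using insert.prems(2) insert.hyps(2) that by (auto simp: pairwise_insert)
      then show ?thesis by (rule coprime_dvd_mult_right_iff)
    qed
    then show ?thesis by (simp add: A_def)
  qed
  then have sub: "(\<lambda>m. int q * m) ` A \<subseteq> A" by auto
  have "{n :: int. \<forall>r\<in>insert q Q. \<not> int r dvd n} = A - (\<lambda>m. int q * m) ` A"
  proof -
    have "n \<in> (\<lambda>m. int q * m) ` A \<longleftrightarrow> int q dvd n" if "n \<in> A" for n
      using that dilate by (auto elim!: dvdE)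
    then show ?thesis by (auto simp: A_def)
  qed
  moreover have "has_density (A - (\<lambda>m. int q * m) ` A) (P - P / real q)"
    using dens has_density_dilate[OF dens] insert.prems(1) sub
    by (intro has_density_Diff) auto
  moreover have "P - P / real q = (\<Prod>r\<in>insert q Q. (1 - 1 / real r))"
    using insert.hyps by (simp add: P_def algebra_simps)
  ultimately show ?case by simp
qed

theorem lemma2p10:
  fixes Q :: "nat set"
  assumes "finite Q"
    and "\<And>q. q \<in> Q \<Longrightarrow> prime q"
  shows "has_density {n :: int. \<forall>q\<in>Q. \<not> int q dvd n} (\<Prod>q\<in>Q. (1 - 1 / real q))"
proof (rule has_density_sieve_pairwise_coprime)
  show "q > 0" if "q \<in> Q" for q
    using assms(2)[OF that] by (rule prime_gt_0_nat)
  show "pairwise coprime Q"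
    using assms(2) by (auto simp: pairwise_def intro: primes_coprime)
qed (fact assms(1))

end
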